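(* Let $\bm{C}\in\mathcal{S}^n$ with $\|\bm{C}\|_{\mathrm F}=1$, let $\epsilon>0$ and $\alpha\ge0$, and let $N$ be a positive integer with $N\ge 1/\epsilon^2$. Let $(\bm{X}_k,\bm{\delta}_k)_k$ be generated by the inexact subgradient algorithm described in the context with initial point $\bm{X}_1=\bm{O}$ and error tolerance $\epsilon$, where at each iteration $k$ the point $\bm{\delta}_k\in\Delta^{n-1}$ is chosen so that $G(\bm{X}_k)-g(\bm{X}_k;\bm{\delta}_k)\le\alpha\epsilon$. After $N$ iterations, let $$k^*\in\operatorname{arg\,min}\{\langle\bm{C},\bm{X}_k\rangle\mid k\in I_N\},\qquad I_N:=\{k\in\{1,\dots,N\}\mid g(\bm{X}_k;\bm{\delta}_k)\le\epsilon\}.$$ If $$\langle\bm{C},\bm{X}_{k^*}\rangle<-n(1+\alpha)\epsilon,$$ then $\bm{C}$ is not completely positive.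
   Context: $\mathcal{S}^n$ is the space of real symmetric $n\times n$ matrices with inner product $\langle\bm{A},\bm{B}\rangle=\sum_{i,j}A_{ij}B_{ij}$ and induced Frobenius norm $\|\cdot\|_{\mathrm F}$; $\bm{O}$ is the zero matrix; $B(\bm{O},1)=\{\bm{X}\in\mathcal{S}^n\mid\|\bm{X}\|_{\mathrm F}\le1\}$ and $P_{B(\bm{O},1)}$ is the metric projection onto it. $\Delta^{n-1}=\{\bm{\delta}\in\mathbb{R}^n_+\mid\sum_i\delta_i=1\}$. A matrix $\bm{A}\in\mathcal{S}^n$ is completely positive if $\bm{A}=\sum_{i=1}^k\bm{a}_i\bm{a}_i^\top$ for some positive integer $k$ and entrywise nonnegative $\bm{a}_1,\dots,\bm{a}_k\in\mathbb{R}^n_+$. For $\bm{X}\in\mathcal{S}^n$ and $\bm{\delta}\in\Delta^{n-1}$ let $f(\bm{X})=\langle\bm{C},\bm{X}\rangle$, $g(\bm{X};\bm{\delta})=\langle\bm{X},-\bm{\delta}\bm{\delta}^\top\rangle=-\bm{\delta}^\top\bm{X}\bm{\delta}$ and $G(\bm{X})=\max_{\bm{\delta}\in\Delta^{n-1}}g(\bm{X};\bm{\delta})$. The underlying problem is to minimize $f(\bm{X})$ over $\bm{X}\in B(\bm{O},1)$ subject to $g(\bm{X};\bm{\delta})\le0$ for all $\bm{\delta}\in\Delta^{n-1}$ (i.e. $\bm{X}$ copositive). Algorithm. For $k=1,2,\dots$: choose $\bm{\delta}_k\in\Delta^{n-1}$ (approximately attaining $G(\bm{X}_k)$). (i) If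 $g(\bm{X}_k;\bm{\delta}_k)\le\epsilon$, let $\bm{D}_k=\bm{C}$ (the gradient of $f$) and $\bm{X}_{k+1}=P_{B(\bm{O},1)}\left(\bm{X}_k-\frac{\epsilon}{\|\bm{D}_k\|_{\mathrm F}^2}\bm{D}_k\right)$. (ii) Otherwise, let $\bm{D}_k=-\bm{\delta}_k\bm{\delta}_k^\top$ (the gradient of $g(\cdot;\bm{\delta}_k)$) and $\bm{X}_{k+1}=P_{B(\bm{O},1)}\left(\bm{X}_k-\frac{g(\bm{X}_k;\bm{\delta}_k)}{\|\bm{D}_k\|_{\mathrm F}^2}\bm{D}_k\right)$. *)

theory Defs
  imports "HOL-Analysis.Analysis"
begin

text \<open>
  The space of symmetric matrices of size \<open>n = CARD('n)\<close> is the subspace \<open>sym_mats\<close> of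
  \<open>real^'n^'n\<close>. The library inner product of \<open>real^'n^'n\<close> is the entrywise one, so \<open>norm\<close> is
  the Frobenius norm (both confirmed below), and \<open>closest_point\<close> is the metric projection.
\<close>

definition sym_mats :: "(real^'n^'n) set" where
  "sym_mats = {A. transpose A = A}"

lemma inner_matrix_eq: "(A::real^'n^'n) \<bullet> B = (\<Sum>i\<in>UNIV. \<Sum>j\<in>UNIV. A $ i $ j * B $ i $ j)"
  by (simp add: inner_vec_def)

lemma norm_matrix_eq: "norm (A::real^'n^'n) = sqrt (\<Sum>i\<in>UNIV. \<Sum>j\<in>UNIV. (A $ i $ j)\<^sup>2)"
  by (simp add: norm_eq_sqrt_inner inner_matrix_eq power2_eq_square)

definition sym_unit_ball :: "(real^'n^'n) set" where
  "sym_unit_ball = {X \<in> sym_mats. norm X \<le> 1}"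

definition proj_ball :: "real^'n^'n \<Rightarrow> real^'n^'n" where
  "proj_ball = closest_point sym_unit_ball"

definition std_simplex :: "(real^'n) set" where
  "std_simplex = {\<delta>. (\<forall>i. 0 \<le> \<delta> $ i) \<and> (\<Sum>i\<in>UNIV. \<delta> $ i) = 1}"

definition self_outer :: "real^'n \<Rightarrow> real^'n^'n" where
  "self_outer a = (\<chi> i j. a $ i * a $ j)"

definition completely_positive :: "real^'n^'n \<Rightarrow> bool" where
  "completely_positive A \<longleftrightarrow>
     (\<exists>k>0. \<exists>a :: nat \<Rightarrow> real^'n.
        (\<forall>i\<in>{1..k}. \<forall>j. 0 \<le> a i $ j) \<and> A = (\<Sum>i=1..k. self_outer (a i)))"

definition g_con :: "real^'n^'n \<Rightarrow> real^'n \<Rightarrow> real" where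
  "g_con X \<delta> = X \<bullet> (- self_outer \<delta>)"

text \<open>The supremum is a maximum, see \<open>G_max_attained\<close> below.\<close>

definition G_max :: "real^'n^'n \<Rightarrow> real" where
  "G_max X = (SUP \<delta>\<in>std_simplex. g_con X \<delta>)"

lemma g_con_eq_quadratic_form: "g_con X \<delta> = - (\<delta> \<bullet> (X *v \<delta>))"
  by (simp add: g_con_def self_outer_def inner_matrix_eq matrix_vector_mult_def inner_vec_def
      sum_distrib_left sum_negf mult_ac)

lemma compact_std_simplex: "compact (std_simplex :: (real^'n) set)"
proof -
  have "std_simplex = (\<Inter>i. {\<delta>::real^'n. 0 \<le> \<delta> $ i}) \<inter> {\<delta>. (\<Sum>i\<in>UNIV. \<delta> $ i) = 1}"
    by (auto simp: std_simplex_def)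
  moreover have "closed ((\<Inter>i. {\<delta>::real^'n. 0 \<le> \<delta> $ i}) \<inter> {\<delta>. (\<Sum>i\<in>UNIV. \<delta> $ i) = 1})"
    by (intro closed_Int closed_INT ballI closed_Collect_le closed_Collect_eq continuous_intros)
  moreover have "norm \<delta> \<le> 1" if "\<delta> \<in> std_simplex" for \<delta> :: "real^'n"
    using that norm_le_l1_cart[of \<delta>] by (simp add: std_simplex_def)
  ultimately show ?thesis
    by (simp add: compact_eq_bounded_closed bounded_iff) blast
qed

lemma std_simplex_nonempty: "(std_simplex :: (real^'n) set) \<noteq> {}"
proof -
  have "axis undefined 1 \<in> (std_simplex :: (real^'n) set)"
    by (simp add: std_simplex_def axis_def)
  then show ?thesis by blast
qed

lemma G_max_attained:
  "\<exists>\<delta>\<in>std_simplex. g_con X \<delta> = G_max X \<and> (\<forall>\<eta>\<in>std_simplex. g_con X \<eta> \<le> g_con X \<delta>)"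
proof -
  have "continuous_on std_simplex (g_con X)"
    unfolding g_con_eq_quadratic_form[abs_def] by (intro continuous_intros)
  then obtain \<delta> where d: "\<delta> \<in> std_simplex" "\<forall>\<eta>\<in>std_simplex. g_con X \<eta> \<le> g_con X \<delta>"
    using continuous_attains_sup[OF compact_std_simplex std_simplex_nonempty] by blast
  then have "G_max X = g_con X \<delta>"
    unfolding G_max_def by (intro cSup_eq_maximum) auto
  with d show ?thesis by auto
qed

text \<open>
  The direction is the gradient of the objective if the constraint is satisfied up to \<open>\<epsilon>\<close>, and
  the gradient of \<open>\<lambda>X. g_con X \<delta>\<close> otherwise; the step length is \<open>step_num \<epsilon> X \<delta> / \<parallel>D\<parallel>\<^sup>2\<close>.
\<close>

definition step_dir :: "real^'n^'n \<Rightarrow> real \<Rightarrow> real^'n^'n \<Rightarrow> real^'n \<Rightarrow> real^'n^'n" where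
  "step_dir C \<epsilon> X \<delta> = (if g_con X \<delta> \<le> \<epsilon> then C else - self_outer \<delta>)"

definition step_num :: "real \<Rightarrow> real^'n^'n \<Rightarrow> real^'n \<Rightarrow> real" where
  "step_num \<epsilon> X \<delta> = (if g_con X \<delta> \<le> \<epsilon> then \<epsilon> else g_con X \<delta>)"

definition subgradient_step :: "real^'n^'n \<Rightarrow> real \<Rightarrow> real^'n^'n \<Rightarrow> real^'n \<Rightarrow> real^'n^'n" where
  "subgradient_step C \<epsilon> X \<delta> =
     (let D = step_dir C \<epsilon> X \<delta>
      in proj_ball (X - (step_num \<epsilon> X \<delta> / (norm D)\<^sup>2) *\<^sub>R D))"

text \<open>Sequences are indexed from 1; their values at index 0 are irrelevant.\<close>

definition subgradient_run ::
  "real^'n^'n \<Rightarrow> real \<Rightarrow> (nat \<Rightarrow> real^'n^'n) \<Rightarrow> (nat \<Rightarrow> real^'n) \<Rightarrow> bool" where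
  "subgradient_run C \<epsilon> X \<delta> \<longleftrightarrow>
     (\<forall>k\<ge>1. \<delta> k \<in> std_simplex \<and> X (Suc k) = subgradient_step C \<epsilon> (X k) (\<delta> k))"

definition near_feasible_iters ::
  "real \<Rightarrow> (nat \<Rightarrow> real^'n^'n) \<Rightarrow> (nat \<Rightarrow> real^'n) \<Rightarrow> nat \<Rightarrow> nat set" where
  "near_feasible_iters \<epsilon> X \<delta> N = {k \<in> {1..N}. g_con (X k) (\<delta> k) \<le> \<epsilon>}"

end

theory Submission
  imports Defs
begin

text \<open>
  A copositivity violation of \<open>X\<close> bounded by \<open>t\<close> on the simplex scales to
  \<open>\<langle>X, aa\<^sup>T\<rangle> \<ge> - t (\<Sum>\<^sub>i a\<^sub>i)\<^sup>2\<close> for all nonnegative \<open>a\<close>. Since \<open>(\<Sum>\<^sub>i a\<^sub>i)\<^sup>2 = \<langle>aa\<^sup>T, ee\<^sup>T\<rangle>\<close> with \<open>e\<close> the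
  all-ones vector, summing over a completely positive decomposition of \<open>C\<close> gives
  \<open>\<langle>C, X\<rangle> \<ge> - t \<langle>C, ee\<^sup>T\<rangle> \<ge> - t n \<parallel>C\<parallel>\<close> by Cauchy--Schwarz. The iterate \<open>k\<^sup>*\<close> satisfies this with
  \<open>t = (1 + \<alpha>) \<epsilon>\<close>, because \<open>G\<close> exceeds \<open>g\<close> at \<open>\<delta>\<^sub>k\<close> by at most \<open>\<alpha> \<epsilon>\<close>.
\<close>

lemma self_outer_scaleR: "self_outer (c *\<^sub>R a) = c\<^sup>2 *\<^sub>R self_outer a"
  by (simp add: self_outer_def vec_eq_iff power2_eq_square mult_ac)

text \<open>With \<open>b = 1\<close> this makes a squared coordinate sum linear in
  \<open>self_outer a\<close>, so it can be summed over a decomposition.\<close>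

lemma inner_self_outer: "self_outer a \<bullet> self_outer b = (a \<bullet> b)\<^sup>2"
  by (simp add: self_outer_def inner_matrix_eq inner_vec_def power2_eq_square sum_product mult_ac)

lemma norm_self_outer: "norm (self_outer a) = (norm a)\<^sup>2"
  by (simp add: norm_eq_sqrt_inner[of "self_outer a"] inner_self_outer power2_norm_eq_inner)

text \<open>In \<open>real^'n\<close>, \<open>1\<close> is the all-ones vector; the norm of the
  all-ones matrix supplies the factor n.\<close>

lemma norm_self_outer_1: "norm (self_outer (1 :: real^'n)) = real CARD('n)"
  by (simp add: norm_self_outer power2_norm_eq_inner inner_vec_def)

lemma G_max_upper: "\<delta> \<in> std_simplex \<Longrightarrow> g_con X \<delta> \<le> G_max X"
  using G_max_attained[of X] by auto

lemma inner_self_outer_ge: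
  fixes X :: "real^'n^'n"
  assumes "\<And>\<delta>. \<delta> \<in> std_simplex \<Longrightarrow> g_con X \<delta> \<le> t" and nonneg: "\<And>i. 0 \<le> a $ i"
  shows "- t * (a \<bullet> 1)\<^sup>2 \<le> X \<bullet> self_outer a"
proof -
  define s where "s = a \<bullet> 1"
  have s: "s = (\<Sum>i\<in>UNIV. a $ i)"
    by (simp add: s_def inner_vec_def)
  \<comment> \<open>If \<open>s = 0\<close>, then \<open>a = 0\<close> and cannot be normalized;
    otherwise \<open>a\<close> divided by \<open>s\<close> lies in the simplex, and both sides are
    homogeneous of degree 2 in \<open>a\<close>.\<close>
  show ?thesis
  proof (cases "s = 0")
    case True
    then have "a = 0"
      using nonneg by (simp add: s sum_nonneg_eq_0_iff vec_eq_iff)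
    then show ?thesis
      by (simp add: self_outer_def inner_matrix_eq)
  next
    case False
    then have "s > 0"
      using nonneg by (simp add: s sum_nonneg order_less_le)
    define \<delta> where "\<delta> = inverse s *\<^sub>R a"
    have "\<delta> \<in> std_simplex"
      using nonneg \<open>s > 0\<close> by (simp add: std_simplex_def \<delta>_def sum_distrib_left[symmetric] s[symmetric])
    then have "- t \<le> X \<bullet> self_outer \<delta>"
      using assms(1)[of \<delta>] by (simp add: g_con_def)
    moreover have "X \<bullet> self_outer a = s\<^sup>2 * (X \<bullet> self_outer \<delta>)"
      using False by (simp add: \<delta>_def self_outer_scaleR power_inverse)
    ultimately show ?thesis
      using mult_left_mono[of "- t" "X \<bullet> self_outer \<delta>" "s\<^sup>2"] by (simp add: s_def mult.commute)
  qed
qed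

lemma completely_positive_inner_ge:
  fixes C X :: "real^'n^'n"
  assumes "completely_positive C" and "\<And>\<delta>. \<delta> \<in> std_simplex \<Longrightarrow> g_con X \<delta> \<le> t" and "t \<ge> 0"
  shows "- real CARD('n) * t * norm C \<le> C \<bullet> X"
proof -
  obtain k :: nat and a :: "nat \<Rightarrow> real^'n"
    where nonneg: "\<And>i j. i \<in> {1..k} \<Longrightarrow> 0 \<le> a i $ j" and C: "C = (\<Sum>i=1..k. self_outer (a i))"
    using assms(1) unfolding completely_positive_def by blast
  have "C \<bullet> self_outer 1 \<le> real CARD('n) * norm C"
    using norm_cauchy_schwarz[of C "self_outer 1"] by (simp add: norm_self_outer_1 mult.commute)
  then have "- real CARD('n) * t * norm C \<le> - t * (C \<bullet> self_outer 1)"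
    using mult_left_mono[OF _ \<open>t \<ge> 0\<close>] by (fastforce simp: mult_ac)
  also have "\<dots> = (\<Sum>i=1..k. - t * (a i \<bullet> 1)\<^sup>2)"
    by (simp add: C inner_sum_left inner_self_outer sum_distrib_left sum_negf)
  also have "\<dots> \<le> (\<Sum>i=1..k. X \<bullet> self_outer (a i))"
    using assms(2) nonneg by (intro sum_mono inner_self_outer_ge) auto
  also have "\<dots> = C \<bullet> X"
    by (simp add: C inner_sum_right inner_commute[of _ X])
  finally show ?thesis .
qed

theorem theorem4p8:
  fixes C :: "real^'n^'n"
    and \<epsilon> \<alpha> :: real
    and N kstar :: nat
    and X :: "nat \<Rightarrow> real^'n^'n"
    and \<delta> :: "nat \<Rightarrow> real^'n"
  assumes "C \<in> sym_mats" and "norm C = 1"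
    and "\<epsilon> > 0" and "\<alpha> \<ge> 0"
    and "N > 0" and "real N \<ge> 1 / \<epsilon>\<^sup>2"
    and "X 1 = 0"
    and "subgradient_run C \<epsilon> X \<delta>"
    and "\<And>k. k \<ge> 1 \<Longrightarrow> G_max (X k) - g_con (X k) (\<delta> k) \<le> \<alpha> * \<epsilon>"
    and "is_arg_min (\<lambda>k. C \<bullet> X k) (\<lambda>k. k \<in> near_feasible_iters \<epsilon> X \<delta> N) kstar"
    and "C \<bullet> X kstar < - real CARD('n) * (1 + \<alpha>) * \<epsilon>"
  shows "\<not> completely_positive C"
proof
  assume cp: "completely_positive C"
  have k: "kstar \<ge> 1" "g_con (X kstar) (\<delta> kstar) \<le> \<epsilon>"
    using assms(10) by (auto simp: is_arg_min_def near_feasible_iters_def)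
  have "G_max (X kstar) \<le> (1 + \<alpha>) * \<epsilon>"
    using assms(9)[OF k(1)] k(2) by (simp add: algebra_simps)
  then have "g_con (X kstar) \<eta> \<le> (1 + \<alpha>) * \<epsilon>" if "\<eta> \<in> std_simplex" for \<eta>
    using G_max_upper[OF that] order_trans by blast
  \<comment> \<open>As \<open>norm C = 1\<close>, the lower bound is exactly the threshold that
    \<open>C \<bullet> X kstar\<close> was assumed to undercut.\<close>
  from completely_positive_inner_ge[OF cp this] show False
    using assms(2,3,4,11) by simp
qed

end
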